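(* Let $\pi_n\in S_n$ be a uniformly random permutation and let $d_n(1),\dots,d_n(n)$ be the degree sequence of the associated permutation graph $G_{\pi_n}$. Then, as $n\to\infty$, $$\sqrt{n}\left(\frac{d_n(\lceil n/2\rceil)}{n}-\frac12\right)\to N(0,U(1-U))\quad\text{in distribution},$$ where $U$ is uniformly distributed on $[0,1]$.
   Context: $S_n$ is the set of permutations of $[n]=\{1,\dots,n\}$. The permutation graph $G_{\pi_n}$ of $\pi_n\in S_n$ has vertex set $[n]$ and an edge between $i$ and $j$ iff $(i-j)(\pi_n(i)-\pi_n(j))<0$; $d_n(i)$ is the degree of vertex $i$. $N(0,U(1-U))$ denotes the mixture of normal laws: conditionally on $U=u$ it is normal with mean $0$ and variance $u(1-u)$. *)

theory Defs
  imports "HOL-Probability.Probability"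
begin

definition perm_graph_edges :: "nat \<Rightarrow> (nat \<Rightarrow> nat) \<Rightarrow> nat set set" where
  "perm_graph_edges n p =
     {{i, j} | i j. i \<in> {1..n} \<and> j \<in> {1..n} \<and> (int i - int j) * (int (p i) - int (p j)) < 0}"

(* Counting incident edges is the degree because no edge is a loop. *)
definition perm_graph_degree :: "nat \<Rightarrow> (nat \<Rightarrow> nat) \<Rightarrow> nat \<Rightarrow> nat" where
  "perm_graph_degree n p i = card {e \<in> perm_graph_edges n p. i \<in> e}"

definition uniform_perm :: "nat \<Rightarrow> (nat \<Rightarrow> nat) pmf" where
  "uniform_perm n = pmf_of_set {p. p permutes {1..n}}"

(* The second parameter is the variance, whereas normal_density takes the standard deviation.
   For variance 0 the formula of normal_density is identically 0, so the point mass
   is a separate case. *)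
definition normal_law :: "real \<Rightarrow> real \<Rightarrow> real measure" where
  "normal_law m v =
     (if v = 0 then return borel m else density lborel (normal_density m (sqrt v)))"

definition normal_mixture :: "real measure" where
  "normal_mixture = uniform_measure lborel {0..1} \<bind> (\<lambda>u. normal_law 0 (u * (1 - u)))"

(* Giry_Monad.bind is only meaningful for measurable kernels. The next lemmas
   establish measurability and that the mixture is a probability law on the reals. *)
lemma normal_law_0_eq_distr:
  "normal_law 0 v = distr (density lborel std_normal_density) borel (\<lambda>z. sqrt v * z)"
proof (cases "v = 0")
  case True
  interpret prob_space "density lborel std_normal_density"
    by (rule prob_space_normal_density) simp
  have "distr (density lborel std_normal_density) borel (\<lambda>z. 0::real) = return borel 0"
    by (rule distr_const) simp
  then show ?thesis
    using True by (simp add: normal_law_def)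
next
  case False
  interpret prob_space "density lborel std_normal_density"
    by (rule prob_space_normal_density) simp
  have "distributed (density lborel std_normal_density) lborel (\<lambda>z. z) std_normal_density"
    by (auto simp: distributed_def distr_id2)
  then have "distributed (density lborel std_normal_density) lborel
      (\<lambda>z. 0 + sqrt v * z) (normal_density (0 + sqrt v * 0) (\<bar>sqrt v\<bar> * 1))"
    by (rule normal_density_affine) (use False in auto)
  then have "distr (density lborel std_normal_density) lborel (\<lambda>z. sqrt v * z)
      = density lborel (normal_density 0 \<bar>sqrt v\<bar>)"
    by (simp add: distributed_def)
  also have "normal_density 0 \<bar>sqrt v\<bar> = normal_density 0 (sqrt v)"
    by (simp add: normal_density_def fun_eq_iff)
  finally show ?thesis
    using False by (simp add: normal_law_def cong: distr_cong)
qed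

lemma prob_space_normal_law_0: "prob_space (normal_law 0 v)"
  unfolding normal_law_0_eq_distr
  by (rule prob_space.prob_space_distr[OF prob_space_normal_density]) auto

lemma measurable_normal_law_0 [measurable]:
  "normal_law 0 \<in> borel \<rightarrow>\<^sub>M prob_algebra borel"
proof -
  have "density lborel std_normal_density \<in> space (subprob_algebra borel)"
    by (auto simp: space_subprob_algebra intro!: prob_space_imp_subprob_space prob_space_normal_density)
  then have "(\<lambda>v. distr (density lborel std_normal_density) borel (\<lambda>z. sqrt v * z))
      \<in> borel \<rightarrow>\<^sub>M subprob_algebra borel"
    by (intro measurable_distr2[where M=borel]) auto
  then show ?thesis
    using prob_space_normal_law_0
    by (auto simp: normal_law_0_eq_distr[abs_def] prob_algebra_def intro!: measurable_restrict_space2)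
qed

lemma real_distribution_normal_mixture: "real_distribution normal_mixture"
proof -
  have U: "uniform_measure lborel {0..1::real} \<in> space (prob_algebra borel)"
    by (auto simp: space_prob_algebra intro!: prob_space_uniform_measure)
  have K: "(\<lambda>u. normal_law 0 (u * (1 - u))) \<in> borel \<rightarrow>\<^sub>M prob_algebra borel"
    by measurable
  show ?thesis
    unfolding normal_mixture_def real_distribution_def real_distribution_axioms_def
    using prob_space_bind'[OF U K] sets_bind'[OF U K] sets_eq_imp_space_eq[OF sets_bind'[OF U K]]
    by simp
qed

end

theory Submission
  imports Defs "HOL-Real_Asymp.Real_Asymp"
begin

text \<open>
  The degree of a vertex \<open>m\<close> depends on the permutation \<open>p\<close> only through the set \<open>S\<close> of
  positions \<open>j\<close> with \<open>p j < p m\<close>: the neighbours of \<open>m\<close> are the positions to its left outside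
  \<open>S\<close> and the positions to its right inside \<open>S\<close>. A given \<open>S\<close> comes from exactly
  \<open>|S|! (n - 1 - |S|)!\<close> permutations, and the Beta integral turns this count into
  \<open>n!\<close> times the integral of \<open>u ^ |S| * (1 - u) ^ (n - 1 - |S|)\<close> over the unit interval.
  So \<open>S\<close> has the same law as a random set that, conditionally on a uniform variable \<open>U\<close>, contains
  every position other than \<open>m\<close> independently with probability \<open>U\<close>: ranking i.i.d. uniform variables and
  conditioning on the one at position \<open>m\<close> explains why. Given \<open>U = u\<close>, the degree
  is thus a sum of \<open>m - 1\<close> Bernoulli variables of parameter \<open>1 - u\<close> and \<open>n - m\<close> of parameter
  \<open>u\<close>, which gives the generating function in \<open>expectation_power_perm_graph_degree\<close>.

  For the central position the two kinds of factors balance. After centring, a factor of one kind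
  and a factor of the other are conjugate, with product
  \<open>1 - 2 u (1 - u) (1 - cos s)\<close> at the frequency \<open>s = t / sqrt n\<close>
  (\<open>centred_bernoulli_char_mult\<close>). About \<open>n / 2\<close> such pairs occur, so the
  characteristic function of the rescaled degree, conditionally on \<open>U = u\<close>, tends
  to \<open>exp (- u (1 - u) t\<^sup>2 / 2)\<close>, the characteristic function of the normal law of variance
  \<open>u (1 - u)\<close>. Dominated convergence in \<open>u\<close> and Levy's continuity theorem conclude.
\<close>

section \<open>Counting permutations by the positions of smaller values\<close>

definition positions_below :: "nat \<Rightarrow> (nat \<Rightarrow> nat) \<Rightarrow> nat \<Rightarrow> nat set" where
  "positions_below n p m = {j \<in> {1..n}. p j < p m}"

text \<open>
  A position to the left of \<open>m\<close> forms an inversion with \<open>m\<close> when its value is larger, a position to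
  the right when its value is smaller.
\<close>
lemma perm_graph_degree_eq:
  assumes "p permutes {1..n}" "m \<in> {1..n}"
  shows "perm_graph_degree n p m =
    card ({1..<m} - positions_below n p m) + card (positions_below n p m \<inter> {m<..n})"
proof -
  let ?X = "{1..<m} - positions_below n p m" and ?Y = "positions_below n p m \<inter> {m<..n}"
  have inj: "p i = p j \<longleftrightarrow> i = j" for i j
    using permutes_inj[OF assms(1)] by (auto dest: injD)
  have nbr: "(int m - int j) * (int (p m) - int (p j)) < 0 \<longleftrightarrow> j \<in> ?X \<union> ?Y" if "j \<in> {1..n}" for j
    using that assms(2) inj[of j m]
    by (auto simp: positions_below_def mult_less_0_iff not_less le_less)
  have sym: "(int j - int m) * (int (p j) - int (p m)) = (int m - int j) * (int (p m) - int (p j))" for j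
    by (simp add: algebra_simps)
  have sub: "?X \<union> ?Y \<subseteq> {1..n}"
    using assms(2) by auto
  have "{e \<in> perm_graph_edges n p. m \<in> e} = (\<lambda>j. {m, j}) ` (?X \<union> ?Y)" (is "?L = ?R")
  proof
    show "?L \<subseteq> ?R"
    proof
      fix e assume "e \<in> ?L"
      then obtain i j where e: "e = {i, j}" "i \<in> {1..n}" "j \<in> {1..n}"
          "(int i - int j) * (int (p i) - int (p j)) < 0" and "m = i \<or> m = j"
        unfolding perm_graph_edges_def by blast
      from this(5) show "e \<in> ?R"
      proof
        assume "m = i"
        then have "e = {m, j}" "j \<in> ?X \<union> ?Y" using nbr[OF e(3)] e(1,4) by simp_all
        then show ?thesis by (rule image_eqI)
      next
        assume "m = j"
        then have "e = {m, i}" "i \<in> ?X \<union> ?Y" using nbr[OF e(2)] e(1,4) sym[of i]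
          by (simp_all add: insert_commute)
        then show ?thesis by (rule image_eqI)
      qed
    qed
    show "?R \<subseteq> ?L"
    proof
      fix e assume "e \<in> ?R"
      then obtain j where j: "j \<in> ?X \<union> ?Y" and e: "e = {m, j}" by (rule imageE)
      from sub j have "j \<in> {1..n}" by (rule subsetD)
      with j have "e \<in> perm_graph_edges n p"
        using nbr[of j] assms(2) unfolding perm_graph_edges_def e by blast
      then show "e \<in> ?L" by (simp add: e)
    qed
  qed
  moreover have "inj_on (\<lambda>j. {m, j}) (?X \<union> ?Y)"
    by (auto simp: inj_on_def doubleton_eq_iff)
  ultimately have "perm_graph_degree n p m = card (?X \<union> ?Y)"
    by (simp add: perm_graph_degree_def card_image)
  also have "\<dots> = card ?X + card ?Y"
    by (intro card_Un_disjoint) (auto simp: positions_below_def)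
  finally show ?thesis .
qed

text \<open>
  Since \<open>p\<close> takes every value smaller than \<open>p m\<close>, the set of positions of these values
  determines \<open>p m\<close>.
\<close>
lemma positions_below_image:
  assumes "p permutes {1..n}" "m \<in> {1..n}"
  shows "p ` positions_below n p m = {1..<p m}" "p m = Suc (card (positions_below n p m))"
proof -
  have "p ` positions_below n p m = {i \<in> p ` {1..n}. i < p m}"
    by (auto simp: positions_below_def)
  also have "\<dots> = {1..<p m}"
    using permutes_image[OF assms(1)] permutes_in_image[OF assms(1), of m] assms(2) by auto
  finally show im: "p ` positions_below n p m = {1..<p m}" .
  have "card (p ` positions_below n p m) = card (positions_below n p m)"
    by (rule card_image[OF permutes_inj_on[OF assms(1)]])
  then show "p m = Suc (card (positions_below n p m))"
    using im permutes_in_image[OF assms(1), of m] assms(2) by auto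
qed

lemma ex_perm_positions_below:
  assumes "m \<in> {1..n}" "S \<subseteq> {1..n} - {m}"
  obtains p where "p permutes {1..n}" "positions_below n p m = S"
proof -
  define k where "k = card S"
  define T where "T = {1..n} - {m} - S"
  have fin: "finite S" "finite T"
    using assms finite_subset[OF assms(2)] by (auto simp: T_def)
  have cT: "card T = n - 1 - k"
    using assms fin by (simp add: T_def k_def card_Diff_subset card_Diff_singleton)
  have kn: "k \<le> n - 1"
    using card_mono[OF finite_Diff[OF finite_atLeastAtMost] assms(2)] assms(1)
    by (simp add: k_def card_Diff_singleton)
  have "\<exists>f. bij_betw f S {1..k}"
    using fin by (intro finite_same_card_bij) (simp_all add: k_def)
  then obtain f where f: "bij_betw f S {1..k}" ..
  have "\<exists>g. bij_betw g T {k+2..n}"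
    using fin cT kn by (intro finite_same_card_bij) simp_all
  then obtain g where g: "bij_betw g T {k+2..n}" ..
  \<comment> \<open>Place \<open>S\<close> on the lowest values, \<open>m\<close> immediately above, and all other positions on top.\<close>
  define p where "p = (\<lambda>x. if x \<in> S then f x else if x \<in> {m} then Suc k else if x \<in> T then g x else x)"
  have pS: "bij_betw p S {1..k}"
    using f by (rule bij_betw_cong[THEN iffD1, rotated]) (simp add: p_def)
  have pm: "bij_betw p {m} {Suc k}"
    using assms by (auto simp: p_def bij_betw_def)
  have pT: "bij_betw p T {k+2..n}"
    using g by (rule bij_betw_cong[THEN iffD1, rotated]) (auto simp: p_def T_def)
  have "bij_betw p (S \<union> {m} \<union> T) ({1..k} \<union> {Suc k} \<union> {k+2..n})"
    by (intro bij_betw_combine pS pm pT) auto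
  moreover have A: "S \<union> {m} \<union> T = {1..n}"
    using assms by (auto simp: T_def)
  moreover have "{1..k} \<union> {Suc k} \<union> {k+2..n} = {1..n}"
    using kn assms(1) by auto
  ultimately have "bij_betw p {1..n} {1..n}" by simp
  then have perm: "p permutes {1..n}"
  proof (rule bij_imp_permutes)
    show "p x = x" if "x \<notin> {1..n}" for x
      using that unfolding A[symmetric] p_def by auto
  qed
  have pm': "p m = Suc k"
    using pm by (simp add: bij_betw_def)
  have "positions_below n p m = S"
  proof (intro equalityI subsetI)
    fix x assume "x \<in> positions_below n p m"
    then have x: "x \<in> S \<union> {m} \<union> T" "p x < Suc k"
      unfolding A pm'[symmetric] by (simp_all add: positions_below_def)
    moreover have "x \<noteq> m"
      using x(2) pm' by auto
    moreover have "x \<notin> T"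
      using x(2) bij_betwE[OF pT] by fastforce
    ultimately show "x \<in> S" by blast
  next
    fix x assume "x \<in> S"
    then have "x \<in> {1..n}" "p x \<in> {1..k}"
      using assms(2) bij_betwE[OF pS] by blast+
    then show "x \<in> positions_below n p m"
      by (simp add: positions_below_def pm')
  qed
  with perm show thesis by (rule that)
qed

lemma permutes_restrict:
  assumes "q permutes A" "finite B" "q ` B \<subseteq> B"
  shows "(\<lambda>x. if x \<in> B then q x else x) permutes B"
proof (rule bij_imp_permutes)
  have "inj_on q B"
    using assms(1) by (rule permutes_inj_on)
  then have "bij_betw q B B"
    using endo_inj_surj[OF assms(2,3)] by (simp add: bij_betw_def)
  then show "bij_betw (\<lambda>x. if x \<in> B then q x else x) B B"
    by (rule bij_betw_cong[THEN iffD1, rotated]) simp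
qed simp

text \<open>
  Once one permutation \<open>p0\<close> with the prescribed set \<open>S\<close> is known, the others are exactly the
  composites of \<open>p0\<close> with a permutation of \<open>S\<close> and a permutation of the remaining positions:
  \<open>p m = p0 m\<close> is forced, so the inverse of \<open>p0\<close> composed with \<open>p\<close> fixes \<open>m\<close> and preserves \<open>S\<close>.
\<close>
lemma card_perm_positions_below:
  assumes m: "m \<in> {1..n}" and S: "S \<subseteq> {1..n} - {m}"
  shows "card {p. p permutes {1..n} \<and> positions_below n p m = S} = fact (card S) * fact (n - 1 - card S)"
proof -
  obtain p0 where p0: "p0 permutes {1..n}" "positions_below n p0 m = S"
    using ex_perm_positions_below[OF m S] .
  define T where "T = {1..n} - {m} - S"
  have fin: "finite S" "finite T"
    using S finite_subset[OF S] by (auto simp: T_def)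
  have cT: "card T = n - 1 - card S"
    using assms fin by (simp add: T_def card_Diff_subset card_Diff_singleton)
  have A: "{1..n} = insert m (S \<union> T)" and mST: "m \<notin> S" "m \<notin> T" and disj: "S \<inter> T = {}"
    using assms by (auto simp: T_def)
  let ?F = "\<lambda>(f, g). p0 \<circ> (f \<circ> g)"
  let ?D = "{f. f permutes S} \<times> {g. g permutes T}"
  have "inj_on ?F ?D"
  proof (rule inj_onI, clarify)
    fix f g f' g' assume perm: "f permutes S" "g permutes T" "f' permutes S" "g' permutes T"
      and "p0 \<circ> (f \<circ> g) = p0 \<circ> (f' \<circ> g')"
    then have eq: "f (g x) = f' (g' x)" for x
      using permutes_inj[OF p0(1)] by (auto simp: fun_eq_iff inj_eq)
    have "f x = f' x" for x
    proof (cases "x \<in> S")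
      case True
      then have "g x = x" "g' x = x"
        using perm disj by (auto intro: permutes_not_in)
      then show ?thesis using eq[of x] by simp
    qed (use perm in \<open>simp add: permutes_not_in\<close>)
    moreover have "g x = g' x" for x
      using eq[of x] permutes_inj[OF perm(3)] calculation by (simp add: inj_eq)
    ultimately show "f = f' \<and> g = g'" by auto
  qed
  moreover have "?F ` ?D = {p. p permutes {1..n} \<and> positions_below n p m = S}"
  proof (intro equalityI subsetI)
    fix p assume "p \<in> ?F ` ?D"
    then obtain f g where fg: "f permutes S" "g permutes T" and p: "p = p0 \<circ> (f \<circ> g)" by auto
    have q: "f \<circ> g permutes {1..n}"
      using fg A by (intro permutes_compose) (auto intro: permutes_subset)
    have qm: "f (g m) = m"
      using fg mST by (simp add: permutes_not_in)
    have qS: "f (g x) \<in> S \<longleftrightarrow> x \<in> S" for x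
      using permutes_in_image[OF fg(1), of "g x"] permutes_in_image[OF fg(2), of x]
        permutes_not_in[OF fg(2), of x] disj by auto
    have "positions_below n p m = {x. f (g x) \<in> positions_below n p0 m}"
      using permutes_in_image[OF q] by (auto simp: positions_below_def p qm)
    then have "positions_below n p m = S"
      using p0(2) qS by auto
    then show "p \<in> {p. p permutes {1..n} \<and> positions_below n p m = S}"
      using permutes_compose[OF q p0(1)] p by simp
  next
    fix p assume "p \<in> {p. p permutes {1..n} \<and> positions_below n p m = S}"
    then have p: "p permutes {1..n}" "positions_below n p m = S" by auto
    define q where "q = inv p0 \<circ> p"
    have q: "q permutes {1..n}"
      unfolding q_def by (intro permutes_compose p permutes_inv p0)
    have p0q: "p0 (q x) = p x" for x
      by (simp add: q_def permutes_inverses[OF p0(1)])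
    have pm: "p m = p0 m"
      using positions_below_image(2)[OF p(1) m] positions_below_image(2)[OF p0(1) m] p(2) p0(2) by simp
    have qm: "q m = m"
      by (simp add: q_def pm permutes_inverses[OF p0(1)])
    have qS: "q x \<in> S \<longleftrightarrow> x \<in> S" for x
    proof -
      have "q x \<in> positions_below n p0 m \<longleftrightarrow> x \<in> positions_below n p m"
        using permutes_in_image[OF q, of x] by (auto simp: positions_below_def p0q pm)
      then show ?thesis by (simp add: p(2) p0(2))
    qed
    have qT: "q ` T \<subseteq> T"
    proof
      fix y assume "y \<in> q ` T"
      then obtain x where x: "x \<in> T" "y = q x" by auto
      then have "y \<in> {1..n}" "y \<notin> S"
        using permutes_in_image[OF q, of x] qS[of x] A disj by auto
      moreover have "y \<noteq> m"
        using x mST qm permutes_inj[OF q] by (metis injD)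
      ultimately show "y \<in> T" by (simp add: T_def)
    qed
    let ?f = "\<lambda>x. if x \<in> S then q x else x" and ?g = "\<lambda>x. if x \<in> T then q x else x"
    have "?f permutes S" "?g permutes T"
      using qS qT by (auto intro!: permutes_restrict[OF q] fin)
    moreover have "?f (?g x) = q x" for x
      using qT disj A qm qS[of x] permutes_not_in[OF q, of x] by (cases "x = m") auto
    then have "p = ?F (?f, ?g)"
      by (auto simp: fun_eq_iff p0q)
    ultimately show "p \<in> ?F ` ?D" by blast
  qed
  ultimately have "card {p. p permutes {1..n} \<and> positions_below n p m = S} = card ?D"
    by (metis (no_types, lifting) card_image)
  also have "\<dots> = fact (card S) * fact (card T)"
    by (simp add: card_cartesian_product card_permutations fin)
  finally show ?thesis by (simp add: cT)
qed

section \<open>Integrals against the uniform law and mixtures of normal laws\<close>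

abbreviation uniform01 :: "real measure" where
  "uniform01 \<equiv> uniform_measure lborel {0..1}"

lemma prob_space_uniform01: "prob_space uniform01"
  by (rule prob_space_uniform_measure) auto

lemma AE_uniform01: "AE u in uniform01. u \<in> {0..1}"
  by (rule AE_uniform_measureI) auto

text \<open>
  Evaluates Lebesgue integrals against the uniform law by gauge integrals, in which the Beta
  integral is available.
\<close>
lemma integral_uniform01_real:
  fixes f :: "real \<Rightarrow> real"
  assumes [measurable]: "f \<in> borel_measurable borel" and nn: "\<And>u. u \<in> {0..1} \<Longrightarrow> 0 \<le> f u"
    and I: "(f has_integral I) {0..1}"
  shows "(\<integral>u. f u \<partial>uniform01) = I"
proof -
  have "(\<integral>\<^sup>+u. f u \<partial>uniform01) = (\<integral>\<^sup>+u. ennreal (indicator {0..1} u * f u) \<partial>lborel)"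
    by (subst nn_integral_uniform_measure)
       (auto simp: indicator_def divide_ennreal_def intro!: nn_integral_cong)
  also have "\<dots> = I"
    by (rule nn_integral_has_integral_lebesgue[OF nn I]) auto
  finally have "(\<integral>\<^sup>+u. f u \<partial>uniform01) = I" .
  moreover have "0 \<le> I"
    using I nn by (rule has_integral_nonneg)
  moreover have "AE u in uniform01. 0 \<le> f u"
    using AE_uniform01 by eventually_elim (use nn in auto)
  ultimately show ?thesis
    by (subst integral_eq_nn_integral) auto
qed

lemma integral_uniform01_Beta:
  "(\<integral>u. u ^ a * (1 - u) ^ b \<partial>uniform01) = fact a * fact b / fact (a + b + 1)"
proof (rule integral_uniform01_real)
  have "((\<lambda>u. u powr (real (a + 1) - 1) * (1 - u) powr (real (b + 1) - 1)) has_integral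
      Beta (real (a + 1)) (real (b + 1))) {0..1}"
    by (rule has_integral_Beta_real) auto
  moreover have "Beta (real (a + 1)) (real (b + 1)) = fact a * fact b / fact (a + b + 1)"
    using Gamma_fact[of a, where 'a = real] Gamma_fact[of b, where 'a = real]
      Gamma_fact[of "a + b + 1", where 'a = real]
    by (simp add: Beta_def algebra_simps)
  ultimately have "((\<lambda>u. u powr (real (a + 1) - 1) * (1 - u) powr (real (b + 1) - 1)) has_integral
      fact a * fact b / fact (a + b + 1)) (cbox 0 1)" by simp
  \<comment> \<open>At the endpoints the two integrands can differ, since \<open>0 powr 0 = 0\<close> but \<open>0 ^ 0 = 1\<close>.\<close>
  then show "((\<lambda>u. u ^ a * (1 - u) ^ b) has_integral fact a * fact b / fact (a + b + 1)) {0..1::real}"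
    unfolding box_real(2)[symmetric]
    by (rule has_integral_spike_interior) (simp add: powr_realpow)
qed auto

text \<open>
  Applied to \<open>iexp\<close>, this says that the characteristic function of a mixture is the mixture of the
  characteristic functions. It reduces to the real and imaginary parts, which are bounded by the
  modulus.
\<close>
lemma integral_bind_complex:
  fixes f :: "_ \<Rightarrow> complex"
  assumes f[measurable]: "f \<in> borel_measurable K" and bd: "\<And>x. x \<in> space K \<Longrightarrow> norm (f x) \<le> B"
    and M: "prob_space M" and N: "N \<in> measurable M (prob_algebra K)"
  shows "(\<integral>x. f x \<partial>(M \<bind> N)) = (\<integral>u. (\<integral>x. f x \<partial>N u) \<partial>M)"
proof -
  have sub: "N \<in> measurable M (subprob_algebra K)"
    using N by (rule measurable_prob_algebraD)
  note [measurable] = sub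
  have Nx: "prob_space (N u)" "sets (N u) = sets K" if "u \<in> space M" for u
    using measurable_space[OF N that] by (auto simp: space_prob_algebra)
  have M': "M \<in> space (prob_algebra M)"
    using M by (simp add: space_prob_algebra)
  interpret M: prob_space M by fact
  interpret b: prob_space "M \<bind> N"
    by (rule prob_space_bind'[OF M' N])
  have sets_b: "sets (M \<bind> N) = sets K"
    by (rule sets_bind'[OF M' N])
  have int_b: "integrable (M \<bind> N) f"
    using bd sets_eq_imp_space_eq[OF sets_b]
    by (intro b.integrable_const_bound[where B=B] AE_I2) (simp_all add: measurable_cong_sets[OF sets_b refl])
  have int_N: "integrable (N u) f" if "u \<in> space M" for u
  proof -
    interpret prob_space "N u" using Nx that by simp
    show ?thesis
      using bd sets_eq_imp_space_eq[OF Nx(2)[OF that]]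
      by (intro integrable_const_bound[where B=B] AE_I2)
         (simp_all add: measurable_cong_sets[OF Nx(2)[OF that] refl])
  qed
  have meas: "(\<lambda>u. \<integral>x. f x \<partial>N u) \<in> borel_measurable M"
    by (rule measurable_compose[OF sub]) measurable
  have int_M: "integrable M (\<lambda>u. \<integral>x. f x \<partial>N u)"
  proof (rule M.integrable_const_bound[where B=B])
    show "AE u in M. norm (\<integral>x. f x \<partial>N u) \<le> B"
    proof (rule AE_I2)
      fix u assume u: "u \<in> space M"
      interpret prob_space "N u" using Nx u by simp
      have "norm (\<integral>x. f x \<partial>N u) \<le> (\<integral>x. norm (f x) \<partial>N u)" by simp
      also have "\<dots> \<le> (\<integral>x. B \<partial>N u)"
        using int_N[OF u] bd sets_eq_imp_space_eq[OF Nx(2)[OF u]]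
        by (intro integral_mono) auto
      finally show "norm (\<integral>x. f x \<partial>N u) \<le> B" by (simp add: prob_space)
    qed
  qed (rule meas)
  have part: "(\<integral>x. g (f x) \<partial>(M \<bind> N)) = (\<integral>u. (\<integral>x. g (f x) \<partial>N u) \<partial>M)"
    if g: "\<And>z. \<bar>g z\<bar> \<le> norm z" "g \<in> borel_measurable borel" for g :: "complex \<Rightarrow> real"
  proof (rule integral_bind[where B'=1 and B=B])
    show "(\<lambda>x. g (f x)) \<in> borel_measurable K"
      using g(2) by measurable
    show "\<bar>g (f x)\<bar> \<le> B" if "x \<in> space K" for x
      using g(1)[of "f x"] bd[OF that] by linarith
    show "AE x in M. emeasure (N x) (space (N x)) \<le> ennreal 1"
      using Nx(1) by (intro AE_I2) (simp add: prob_space.emeasure_space_1)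
  qed (fact sub M.finite_measure_axioms)+
  show ?thesis
  proof (rule complex_eqI)
    have "Re (\<integral>x. f x \<partial>(M \<bind> N)) = (\<integral>u. (\<integral>x. Re (f x) \<partial>N u) \<partial>M)"
      using part[of Re] int_b by (simp add: abs_Re_le_cmod)
    also have "\<dots> = (\<integral>u. Re (\<integral>x. f x \<partial>N u) \<partial>M)"
      using int_N by (intro Bochner_Integration.integral_cong) auto
    finally show "Re (\<integral>x. f x \<partial>(M \<bind> N)) = Re (\<integral>u. (\<integral>x. f x \<partial>N u) \<partial>M)"
      using int_M by simp
    have "Im (\<integral>x. f x \<partial>(M \<bind> N)) = (\<integral>u. (\<integral>x. Im (f x) \<partial>N u) \<partial>M)"
      using part[of Im] int_b by (simp add: abs_Im_le_cmod)
    also have "\<dots> = (\<integral>u. Im (\<integral>x. f x \<partial>N u) \<partial>M)"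
      using int_N by (intro Bochner_Integration.integral_cong) auto
    finally show "Im (\<integral>x. f x \<partial>(M \<bind> N)) = Im (\<integral>u. (\<integral>x. f x \<partial>N u) \<partial>M)"
      using int_M by simp
  qed
qed

text \<open>
  The representation as a rescaled standard normal law also covers the degenerate case \<open>v = 0\<close>.
\<close>
lemma char_normal_law_0: "char (normal_law 0 v) t = exp (- (v * t\<^sup>2 / 2))" if "v \<ge> 0"
proof -
  have "char (normal_law 0 v) t = char std_normal_distribution (sqrt v * t)"
    unfolding normal_law_0_eq_distr char_def
    by (subst integral_distr) (auto simp: algebra_simps)
  then show ?thesis
    using that by (simp add: char_std_normal_distribution power_mult_distrib flip: of_real_power)
qed

lemma char_normal_mixture:
  "char normal_mixture t = (\<integral>u. exp (- (u * (1 - u) * t\<^sup>2 / 2)) \<partial>uniform01)"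
proof -
  have "char normal_mixture t = (\<integral>u. char (normal_law 0 (u * (1 - u))) t \<partial>uniform01)"
    unfolding normal_mixture_def char_def
    by (rule integral_bind_complex[where K=borel and B=1]) (auto intro: prob_space_uniform01)
  also have "\<dots> = (\<integral>u. complex_of_real (exp (- (u * (1 - u) * t\<^sup>2 / 2))) \<partial>uniform01)"
  proof (rule integral_cong_AE)
    show "AE u in uniform01. char (normal_law 0 (u * (1 - u))) t = complex_of_real (exp (- (u * (1 - u) * t\<^sup>2 / 2)))"
      using AE_uniform01 by eventually_elim (simp add: char_normal_law_0)
    have "(\<lambda>u. normal_law 0 (u * (1 - u))) \<in> uniform01 \<rightarrow>\<^sub>M subprob_algebra borel"
      by (intro measurable_prob_algebraD) measurable
    then show "(\<lambda>u. char (normal_law 0 (u * (1 - u))) t) \<in> borel_measurable uniform01"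
      unfolding char_def
      by (rule measurable_compose) (rule integral_measurable_subprob_algebra, simp)
  qed measurable
  finally show ?thesis by simp
qed

section \<open>Generating function of the degree\<close>

text \<open>
  Each position \<open>j\<close> other than \<open>m\<close> contributes a factor, \<open>a + b * z\<close> to the left of \<open>m\<close> and
  \<open>a * z + b\<close> to its right. When the product is multiplied out, \<open>S\<close> collects the positions at
  which the term with \<open>a\<close> is chosen. The exponent of \<open>z\<close> is then the degree of \<open>m\<close> in any permutation whose set of positions below \<open>m\<close>
  is \<open>S\<close>.
\<close>
lemma prod_split_positions:
  fixes a b z :: "'a :: comm_semiring_1"
  assumes m: "m \<in> {1..n}"
  shows "(a + b * z) ^ (m - 1) * (a * z + b) ^ (n - m) =
    (\<Sum>S\<in>Pow ({1..n} - {m}). a ^ card S * b ^ (n - 1 - card S) *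
       z ^ (card ({1..<m} - S) + card (S \<inter> {m<..n})))"
proof -
  let ?A = "{1..n} - {m}"
  let ?f = "\<lambda>j. a * (if m < j then z else 1)" and ?g = "\<lambda>j. b * (if j < m then z else 1)"
  have "(a + b * z) ^ (m - 1) * (a * z + b) ^ (n - m) =
      (\<Prod>j\<in>{1..<m}. ?f j + ?g j) * (\<Prod>j\<in>{m<..n}. ?f j + ?g j)"
    by simp
  also have "\<dots> = (\<Prod>j\<in>{1..<m} \<union> {m<..n}. ?f j + ?g j)"
    by (rule prod.union_disjoint[symmetric]) auto
  also have "{1..<m} \<union> {m<..n} = ?A"
    using m by auto
  also have "(\<Prod>j\<in>?A. ?f j + ?g j) = (\<Sum>S\<in>Pow ?A. (\<Prod>j\<in>S. ?f j) * (\<Prod>j\<in>?A - S. ?g j))"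
    by (rule prod_add) simp
  also have "\<dots> = (\<Sum>S\<in>Pow ?A. a ^ card S * b ^ (n - 1 - card S) *
       z ^ (card ({1..<m} - S) + card (S \<inter> {m<..n})))"
  proof (rule sum.cong[OF refl])
    fix S assume "S \<in> Pow ?A"
    then have S: "S \<subseteq> ?A" and fin: "finite S"
      using finite_subset by auto
    have "card (?A - S) = n - 1 - card S"
      using m S fin by (simp add: card_Diff_subset card_Diff_singleton)
    moreover have "{j \<in> S. m < j} = S \<inter> {m<..n}" "{j \<in> ?A - S. j < m} = {1..<m} - S"
      using S m by auto
    ultimately have "(\<Prod>j\<in>S. ?f j) = a ^ card S * z ^ card (S \<inter> {m<..n})"
        "(\<Prod>j\<in>?A - S. ?g j) = b ^ (n - 1 - card S) * z ^ card ({1..<m} - S)"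
      using fin by (simp_all add: prod.distrib flip: prod.inter_filter)
    then show "(\<Prod>j\<in>S. ?f j) * (\<Prod>j\<in>?A - S. ?g j) = a ^ card S * b ^ (n - 1 - card S) *
       z ^ (card ({1..<m} - S) + card (S \<inter> {m<..n}))"
      by (simp add: power_add mult_ac)
  qed
  finally show ?thesis .
qed

text \<open>
  Grouping the permutations by \<open>S\<close>, the probability of each class is
  \<open>|S|! (n - 1 - |S|)! / n!\<close>, which is the Beta integral of \<open>u ^ |S| * (1 - u) ^ (n - 1 - |S|)\<close>.
  Summing under the integral sign reassembles the product of Bernoulli generating functions.
\<close>
lemma expectation_power_perm_graph_degree:
  fixes z :: complex
  assumes m: "m \<in> {1..n}"
  shows "(\<integral>p. z ^ perm_graph_degree n p m \<partial>measure_pmf (uniform_perm n)) =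
    (\<integral>u. (of_real u + of_real (1 - u) * z) ^ (m - 1) *
         (of_real u * z + of_real (1 - u)) ^ (n - m) \<partial>uniform01)"
proof -
  let ?A = "{1..n} - {m}" and ?P = "{p. p permutes {1..n}}"
  define e where "e S = card ({1..<m} - S) + card (S \<inter> {m<..n})" for S
  have fin: "finite ?P" by (rule finite_permutations) simp
  have ne: "?P \<noteq> {}" using permutes_id by blast
  interpret prob_space uniform01 by (rule prob_space_uniform01)
  have int: "integrable uniform01 (\<lambda>u. of_real (u ^ card S * (1 - u) ^ (n - 1 - card S)) * z ^ e S)" for S
  proof (intro integrable_mult_left integrable_of_real)
    show "integrable uniform01 (\<lambda>u::real. u ^ card S * (1 - u) ^ (n - 1 - card S))"
    proof (rule integrable_const_bound[where B=1])
      show "AE u in uniform01. norm (u ^ card S * (1 - u) ^ (n - 1 - card S)) \<le> 1"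
        using AE_uniform01
        by eventually_elim (auto simp: norm_mult norm_power intro!: mult_le_one power_le_one)
    qed simp
  qed
  have "(\<integral>p. z ^ perm_graph_degree n p m \<partial>measure_pmf (uniform_perm n)) =
      (\<Sum>p\<in>?P. z ^ perm_graph_degree n p m /\<^sub>R fact n)"
    unfolding uniform_perm_def using fin ne
    by (subst integral_measure_pmf[OF fin]) (auto simp: card_permutations divide_inverse)
  also have "\<dots> = (\<Sum>p\<in>?P. z ^ e (positions_below n p m) / fact n)"
    using m by (intro sum.cong) (auto simp: perm_graph_degree_eq e_def scaleR_conv_of_real field_simps)
  also have "\<dots> = (\<Sum>S\<in>Pow ?A. \<Sum>p\<in>{p \<in> ?P. positions_below n p m = S}. z ^ e (positions_below n p m) / fact n)"
    using fin by (intro sum.group[symmetric]) (auto simp: positions_below_def)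
  also have "\<dots> = (\<Sum>S\<in>Pow ?A. of_nat (card {p \<in> ?P. positions_below n p m = S}) * (z ^ e S / fact n))"
    by simp
  also have "\<dots> = (\<Sum>S\<in>Pow ?A. \<integral>u. of_real (u ^ card S * (1 - u) ^ (n - 1 - card S)) * z ^ e S \<partial>uniform01)"
  proof (rule sum.cong[OF refl])
    fix S assume "S \<in> Pow ?A"
    then have S: "S \<subseteq> ?A" by simp
    have "card S \<le> n - 1"
      using card_mono[OF finite_Diff[OF finite_atLeastAtMost] S] m by (simp add: card_Diff_singleton)
    then have n: "card S + (n - 1 - card S) + 1 = n"
      using m by auto
    have "(\<integral>u. of_real (u ^ card S * (1 - u) ^ (n - 1 - card S)) * z ^ e S \<partial>uniform01) =
        of_real (\<integral>u. u ^ card S * (1 - u) ^ (n - 1 - card S) \<partial>uniform01) * z ^ e S"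
      by (simp only: integral_mult_left_zero integral_complex_of_real)
    also have "\<dots> = of_real (fact (card S) * fact (n - 1 - card S) / fact n) * z ^ e S"
      by (simp only: integral_uniform01_Beta n)
    finally show "of_nat (card {p \<in> ?P. positions_below n p m = S}) * (z ^ e S / fact n) =
        (\<integral>u. of_real (u ^ card S * (1 - u) ^ (n - 1 - card S)) * z ^ e S \<partial>uniform01)"
      using card_perm_positions_below[OF m S] by simp
  qed
  also have "\<dots> = (\<integral>u. (\<Sum>S\<in>Pow ?A. of_real (u ^ card S * (1 - u) ^ (n - 1 - card S)) * z ^ e S) \<partial>uniform01)"
    by (rule Bochner_Integration.integral_sum[symmetric]) (rule int)
  also have "\<dots> = (\<integral>u. (of_real u + of_real (1 - u) * z) ^ (m - 1) *
         (of_real u * z + of_real (1 - u)) ^ (n - m) \<partial>uniform01)"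
    unfolding prod_split_positions[OF m] e_def by simp
  finally show ?thesis .
qed

section \<open>The limit of the characteristic functions\<close>

text \<open>
  The base is \<open>1 - c * t\<^sup>2 / n + o(1 / n)\<close> and the exponent is asymptotic to \<open>n / 2\<close>.
\<close>
lemma tendsto_power_half:
  fixes c t :: real
  shows "(\<lambda>n. (1 - 2 * c * (1 - cos (t / sqrt (real n)))) ^ ((n - 1) div 2)) \<longlonglongrightarrow> exp (- (c * t\<^sup>2 / 2))"
proof -
  let ?r = "\<lambda>n. 1 - 2 * c * (1 - cos (t / sqrt (real n)))"
  have "?r \<longlonglongrightarrow> 1" by real_asymp
  then have pos: "\<forall>\<^sub>F n in sequentially. ?r n > 0"
    by (rule order_tendstoD) simp
  have "(\<lambda>n. real n * ln (?r n)) \<longlonglongrightarrow> - (c * t\<^sup>2)"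
    unfolding power2_eq_square by real_asymp
  moreover have "(\<lambda>n. real ((n - 1) div 2) / real n) \<longlonglongrightarrow> 1 / 2"
    by real_asymp
  ultimately have "(\<lambda>n. exp ((real n * ln (?r n)) * (real ((n - 1) div 2) / real n))) \<longlonglongrightarrow> exp (- (c * t\<^sup>2) * (1 / 2))"
    by (intro tendsto_exp tendsto_mult)
  moreover have "\<forall>\<^sub>F n in sequentially. exp ((real n * ln (?r n)) * (real ((n - 1) div 2) / real n)) = ?r n ^ ((n - 1) div 2)"
    using pos eventually_gt_at_top[of 0]
    by eventually_elim (simp add: exp_of_nat2_mult)
  ultimately show ?thesis
    by (simp add: tendsto_cong)
qed

text \<open>
  The factors from the two sides of the centre can be paired, except for a single factor from
  the right if \<open>n\<close> is even.
\<close>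
lemma central_position:
  assumes "n > 0"
  shows "nat \<lceil>real n / 2\<rceil> \<in> {1..n}" "nat \<lceil>real n / 2\<rceil> - 1 = (n - 1) div 2"
    "n - nat \<lceil>real n / 2\<rceil> = (n - 1) div 2 + of_bool (even n)"
proof -
  have "\<lceil>real n / 2\<rceil> = int ((n + 1) div 2)"
  proof (cases "even n")
    case True
    then obtain k where "n = 2 * k" by (elim evenE)
    then show ?thesis by simp
  next
    case False
    then obtain k where "n = 2 * k + 1" by (elim oddE)
    then show ?thesis by (simp add: ceiling_eq_iff)
  qed
  then have m: "nat \<lceil>real n / 2\<rceil> = (n + 1) div 2" by simp
  show "nat \<lceil>real n / 2\<rceil> \<in> {1..n}" "nat \<lceil>real n / 2\<rceil> - 1 = (n - 1) div 2"
    "n - nat \<lceil>real n / 2\<rceil> = (n - 1) div 2 + of_bool (even n)"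
    unfolding m using assms by (auto elim!: evenE oddE)
qed

text \<open>
  The factors are the characteristic functions of \<open>X - 1 / 2\<close> and \<open>Y - 1 / 2\<close> for Bernoulli variables
  \<open>X\<close> and \<open>Y\<close> of parameters \<open>1 - u\<close> and \<open>u\<close>. Since \<open>Y - 1 / 2\<close> has the law of \<open>1 / 2 - X\<close>, they are
  complex conjugates and their product is real.
\<close>
lemma centred_bernoulli_char_mult:
  fixes s u :: real
  defines "a \<equiv> exp (- (\<i> * of_real s / 2))" and "z \<equiv> exp (\<i> * of_real s)"
  shows "(a * (of_real u + of_real (1 - u) * z)) * (a * (of_real u * z + of_real (1 - u))) =
    of_real (1 - 2 * (u * (1 - u)) * (1 - cos s))"
proof -
  have aa: "a * a = cis (- s)" and z: "z = cis s"
    by (simp_all add: a_def z_def cis_conv_exp flip: exp_add)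
  have "(a * (of_real u + of_real (1 - u) * z)) * (a * (of_real u * z + of_real (1 - u))) =
      (a * a) * ((of_real u + of_real (1 - u) * z) * (of_real u * z + of_real (1 - u)))"
    by (simp add: algebra_simps)
  also have "\<dots> = (of_real (u * u) + of_real ((1 - u) * (1 - u))) * (cis (- s) * cis s)
      + of_real (u * (1 - u)) * (cis (- s) * (cis s * cis s)  + cis (- s))"
    unfolding aa z by (simp add: algebra_simps)
  also have "\<dots> = of_real (u * u + (1 - u) * (1 - u)) + of_real (u * (1 - u)) * (cis s + cis (- s))"
    by (simp add: cis_mult)
  also have "\<dots> = of_real (1 - 2 * (u * (1 - u)) * (1 - cos s))"
    by (simp add: complex_eq_iff algebra_simps)
  finally show ?thesis .
qed

text \<open>
  The characteristic function at \<open>s\<close> of the degree of the central vertex minus \<open>n / 2\<close>,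
  conditionally on \<open>U = u\<close>. The middle factor collects the conjugate pairs, the last one is
  the unpaired right neighbour position of an even \<open>n\<close>, and the first one remains because the
  degree has \<open>n - 1\<close> summands but is centred by \<open>n / 2\<close>.
\<close>
definition char_integrand :: "nat \<Rightarrow> real \<Rightarrow> real \<Rightarrow> complex" where
  "char_integrand n s u =
     exp (- (\<i> * of_real s / 2)) *
     of_real ((1 - 2 * (u * (1 - u)) * (1 - cos s)) ^ ((n - 1) div 2)) *
     (exp (- (\<i> * of_real s / 2)) * (of_real u * exp (\<i> * of_real s) + of_real (1 - u))) ^ of_bool (even n)"

text \<open>
  The middle factor is a power of a number in the unit interval because \<open>u * (1 - u) \<le> 1 / 4\<close> and
  \<open>1 - cos s \<le> 2\<close>; the bound dominates the integrands uniformly in \<open>n\<close>.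
\<close>
lemma norm_char_integrand_le_1:
  assumes "u \<in> {0..1}"
  shows "norm (char_integrand n s u) \<le> 1"
proof -
  have "u * (1 - u) \<le> 1 / 4"
    using zero_le_power2[of "u - 1 / 2"] by (simp add: power2_eq_square algebra_simps)
  moreover have "0 \<le> u * (1 - u)"
    using assms by simp
  ultimately have q: "u * (1 - u) \<le> 1 / 4" "0 \<le> u * (1 - u)" .
  have c: "0 \<le> 1 - cos s" "1 - cos s \<le> 2"
    using cos_ge_minus_one[of s] by auto
  have "(u * (1 - u)) * (1 - cos s) \<le> 1 / 4 * 2"
    using q c by (intro mult_mono) auto
  moreover have "0 \<le> (u * (1 - u)) * (1 - cos s)"
    using q c by simp
  ultimately have r: "\<bar>1 - 2 * (u * (1 - u)) * (1 - cos s)\<bar> \<le> 1"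
    by (simp add: abs_le_iff)
  have "norm (of_real u * exp (\<i> * of_real s) + of_real (1 - u)) \<le> u * 1 + (1 - u)"
    using assms by (intro order.trans[OF norm_triangle_ineq]) (simp add: norm_mult del: of_real_diff)
  then have v: "norm (of_real u * exp (\<i> * of_real s) + of_real (1 - u)) \<le> 1" by simp
  have a: "norm (exp (- (\<i> * of_real s / 2))) = 1"
    using norm_exp_i_times[of "- s / 2"] by simp
  have "\<bar>(1 - 2 * (u * (1 - u)) * (1 - cos s)) ^ ((n - 1) div 2)\<bar> \<le> 1"
    using r by (simp only: power_abs power_le_one abs_ge_zero)
  then show ?thesis
    unfolding char_integrand_def norm_mult norm_power norm_of_real a
    using v by (simp add: of_bool_def mult_le_one del: of_real_diff)
qed

lemma char_perm_graph_degree: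
  assumes n: "n > 0"
  shows "char (distr (measure_pmf (uniform_perm n)) borel
      (\<lambda>p. sqrt (real n) *
        (real (perm_graph_degree n p (nat \<lceil>real n / 2\<rceil>)) / real n - 1 / 2))) t =
    (\<integral>u. char_integrand n (t / sqrt (real n)) u \<partial>uniform01)"
proof -
  define m where "m = nat \<lceil>real n / 2\<rceil>"
  define h where "h = (n - 1) div 2"
  define e :: nat where "e = of_bool (even n)"
  define s where "s = t / sqrt (real n)"
  define z where "z = exp (\<i> * of_real s)"
  define a where "a = exp (- (\<i> * of_real s / 2))"
  have m: "m \<in> {1..n}" "m - 1 = h" "n - m = h + e"
    using central_position[OF n] by (simp_all add: m_def h_def e_def)
  \<comment> \<open>The centring factor \<open>a ^ n\<close> supplies one \<open>a\<close> to each of the \<open>h + (h + e)\<close> factors of the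
    generating function and leaves one over.\<close>
  have n_eq: "n = Suc (h + (h + e))"
    using m by auto
  have a_n: "exp (- (\<i> * of_real s / 2) * of_nat n) = a ^ n"
    unfolding a_def by (metis exp_of_nat_mult mult.commute)
  have iexp: "iexp (t * (sqrt (real n) * (real d / real n - 1 / 2))) = a ^ n * z ^ d" for d
  proof -
    have "t * sqrt (real n) = s * real n"
      using n by (simp add: s_def field_simps)
    then have "t * (sqrt (real n) * (real d / real n - 1 / 2)) = s * real n * (real d / real n - 1 / 2)"
      by (metis mult.assoc)
    also have "\<dots> = s * real d - s * real n / 2"
      using n by (simp add: field_simps)
    finally show ?thesis
      by (simp only:) (simp add: algebra_simps z_def flip: exp_add exp_of_nat_mult a_n)
  qed
  have "char (distr (measure_pmf (uniform_perm n)) borel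
      (\<lambda>p. sqrt (real n) * (real (perm_graph_degree n p m) / real n - 1 / 2))) t =
      (\<integral>p. a ^ n * z ^ perm_graph_degree n p m \<partial>measure_pmf (uniform_perm n))"
    unfolding char_def by (subst integral_distr) (simp_all only: iexp, simp_all)
  also have "\<dots> = a ^ n * (\<integral>p. z ^ perm_graph_degree n p m \<partial>measure_pmf (uniform_perm n))"
    by simp
  also have "\<dots> = (\<integral>u. a ^ n * ((of_real u + of_real (1 - u) * z) ^ h *
         (of_real u * z + of_real (1 - u)) ^ (h + e)) \<partial>uniform01)"
    unfolding expectation_power_perm_graph_degree[OF m(1)] m(2,3) by simp
  also have "\<dots> = (\<integral>u. char_integrand n s u \<partial>uniform01)"
  proof (rule Bochner_Integration.integral_cong[OF refl])
    fix u :: real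
    let ?w = "of_real u + of_real (1 - u) * z" and ?v = "of_real u * z + of_real (1 - u)"
    have "a ^ n * (?w ^ h * ?v ^ (h + e)) = a * ((a * ?w) * (a * ?v)) ^ h * (a * ?v) ^ e"
      unfolding n_eq by (simp add: power_mult_distrib power_add mult_ac)
    also have "(a * ?w) * (a * ?v) = of_real (1 - 2 * (u * (1 - u)) * (1 - cos s))"
      unfolding a_def z_def by (rule centred_bernoulli_char_mult)
    finally show "a ^ n * (?w ^ h * ?v ^ (h + e)) = char_integrand n s u"
      by (simp add: char_integrand_def a_def z_def h_def e_def)
  qed
  finally show ?thesis
    by (simp add: m_def s_def)
qed

text \<open>
  Only the power of the conjugate pairs contributes in the limit. The last factor alternates with
  the parity of \<open>n\<close>, but its base tends to 1.
\<close>
lemma tendsto_char_integrand: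
  "(\<lambda>n. char_integrand n (t / sqrt (real n)) u) \<longlonglongrightarrow> of_real (exp (- (u * (1 - u) * t\<^sup>2 / 2)))"
proof -
  have "(\<lambda>n. t / sqrt (real n)) \<longlonglongrightarrow> 0" by real_asymp
  then have s: "(\<lambda>n. complex_of_real (t / sqrt (real n))) \<longlonglongrightarrow> of_real 0"
    by (rule tendsto_of_real)
  let ?a = "\<lambda>n. exp (- (\<i> * of_real (t / sqrt (real n)) / 2))"
  let ?v = "\<lambda>n. ?a n * (of_real u * exp (\<i> * of_real (t / sqrt (real n))) + of_real (1 - u))"
  have "?a \<longlonglongrightarrow> exp (- (\<i> * of_real 0 / 2))"
    by (intro tendsto_intros s) simp
  then have a: "?a \<longlonglongrightarrow> 1" by simp
  have "?v \<longlonglongrightarrow> exp (- (\<i> * of_real 0 / 2)) * (of_real u * exp (\<i> * of_real 0) + of_real (1 - u))"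
    by (intro tendsto_intros s) simp
  then have "(\<lambda>n. ?v n - 1) \<longlonglongrightarrow> 0"
    by (intro LIM_zero) simp
  then have "(\<lambda>n. ?v n ^ of_bool (even n) - 1) \<longlonglongrightarrow> 0"
    by (rule Lim_null_comparison[rotated, OF tendsto_norm_zero]) (simp add: of_bool_def)
  then have v: "(\<lambda>n. ?v n ^ of_bool (even n)) \<longlonglongrightarrow> 1"
    by (rule LIM_zero_cancel)
  have "(\<lambda>n. char_integrand n (t / sqrt (real n)) u) \<longlonglongrightarrow> 1 * of_real (exp (- (u * (1 - u) * t\<^sup>2 / 2))) * 1"
    unfolding char_integrand_def by (intro tendsto_mult a v tendsto_of_real tendsto_power_half)
  then show ?thesis by simp
qed

theorem theorem3p4:
  shows "weak_conv_m
    (\<lambda>n. distr (measure_pmf (uniform_perm n)) borel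
      (\<lambda>p. sqrt (real n) *
        (real (perm_graph_degree n p (nat \<lceil>real n / 2\<rceil>)) / real n - 1 / 2)))
    normal_mixture"
proof (rule levy_continuity)
  fix n
  show "real_distribution (distr (measure_pmf (uniform_perm n)) borel
      (\<lambda>p. sqrt (real n) *
        (real (perm_graph_degree n p (nat \<lceil>real n / 2\<rceil>)) / real n - 1 / 2)))"
    by (rule prob_space.real_distribution_distr[OF prob_space_measure_pmf]) simp
next
  show "real_distribution normal_mixture"
    by (rule real_distribution_normal_mixture)
next
  fix t
  interpret prob_space uniform01 by (rule prob_space_uniform01)
  have "(\<lambda>n. \<integral>u. char_integrand n (t / sqrt (real n)) u \<partial>uniform01)
      \<longlonglongrightarrow> (\<integral>u. of_real (exp (- (u * (1 - u) * t\<^sup>2 / 2))) \<partial>uniform01)"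
  proof (rule integral_dominated_convergence[where w="\<lambda>_. 1"])
    show "AE u in uniform01. norm (char_integrand n (t / sqrt (real n)) u) \<le> 1" for n
      using AE_uniform01 by eventually_elim (rule norm_char_integrand_le_1)
    show "(\<lambda>u. char_integrand n (t / sqrt (real n)) u) \<in> borel_measurable uniform01" for n
      unfolding char_integrand_def by measurable
  qed (simp_all only: tendsto_char_integrand, simp_all)
  then have "(\<lambda>n. \<integral>u. char_integrand n (t / sqrt (real n)) u \<partial>uniform01) \<longlonglongrightarrow> char normal_mixture t"
    by (simp add: char_normal_mixture)
  then show "(\<lambda>n. char (distr (measure_pmf (uniform_perm n)) borel
      (\<lambda>p. sqrt (real n) *
        (real (perm_graph_degree n p (nat \<lceil>real n / 2\<rceil>)) / real n - 1 / 2))) t)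
      \<longlonglongrightarrow> char normal_mixture t"
  proof (rule Lim_transform_eventually)
    show "\<forall>\<^sub>F n in sequentially. (\<integral>u. char_integrand n (t / sqrt (real n)) u \<partial>uniform01) =
        char (distr (measure_pmf (uniform_perm n)) borel
          (\<lambda>p. sqrt (real n) *
            (real (perm_graph_degree n p (nat \<lceil>real n / 2\<rceil>)) / real n - 1 / 2))) t"
      using eventually_gt_at_top[of 0] by eventually_elim (simp add: char_perm_graph_degree)
  qed
qed

end
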